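(* A multiple-conclusion logic $\Vdash$ is compact if and only if $\mathsf{Nmatr}(\Vdash)$ is closed under ultraproducts.
   Context: Fix a countable signature $\Sigma$ (sets $\Sigma^k$ of $k$-ary connectives), a denumerable set $P$ of variables and the set $Fm$ of formulas. A substitution is a map $\sigma:P\to Fm$ extended homomorphically. A multiple-conclusion logic is a relation $\Vdash\subseteq\wp(Fm)\times\wp(Fm)$ such that for all $\Gamma,\Delta,\Gamma',\Delta'\subseteq Fm$: (O) if $\Gamma\cap\Delta\neq\emptyset$ then $\Gamma\Vdash\Delta$; (D) if $\Gamma\Vdash\Delta$ then $\Gamma\cup\Gamma'\Vdash\Delta\cup\Delta'$; (C) if $\Gamma\cup\Omega\Vdash(Fm\setminus\Omega)\cup\Delta$ for every $\Omega\subseteq Fm$ then $\Gamma\Vdash\Delta$; (S) if $\Gamma\Vdash\Delta$ then $\sigma[\Gamma]\Vdash\sigma[\Delta]$ for every substitution $\sigma$. It is compact if whenever $\Gamma\Vdash\Delta$ there are finite $\Gamma_0\subseteq\Gamma$, $\Delta_0\subseteq\Delta$ with $\Gamma_0\Vdash\Delta_0$. A $\Sigma$-Nmatrix is $\mathbb{M}=\langle A,\cdot_{\mathbb{M}},D\rangle$, each $\copyright\in\Sigma^k$ interpreted as $\copyright_{\mathbb{M}}:A^k\to\wp(A)\setminus\{\emptyset\}$, $D\subseteq A$. A valuation is $v:Fm\to A$ with $v(\copyright(\varphi_1,\dots,\varphi_k))\in\copyright_{\mathbb{M}}(v(\varphi_1),\dots,v(\varphi_k))$. $\Gamma\Vdash_{\mathbb{M}}\Delta$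 iff every valuation $v$ with $v[\Gamma]\subseteq D$ has $v[\Delta]\cap D\neq\emptyset$. $\mathsf{Nmatr}(\Vdash)$ is the class of $\Sigma$-Nmatrices $\mathbb{M}$ with $\Vdash\subseteq\Vdash_{\mathbb{M}}$. The product of $\mathbb{M}_i=\langle A_i,\cdot_i,D_i\rangle$, $i\in I$, is $\langle\Pi_{i\in I}A_i,\cdot_I,\Pi_{i\in I}D_i\rangle$ with $\copyright_I(s_1,\dots,s_k)=\Pi_{i\in I}\copyright_i(\pi_i(s_1),\dots,\pi_i(s_k))$. The quotient of an Nmatrix $\langle A,\cdot,D\rangle$ by an equivalence $\equiv$ is $\langle A/{\equiv},\cdot_\equiv,\{[x]:x\in D\}\rangle$ with $\copyright_\equiv([x_1],\dots,[x_k])=\{[y]:y\in\copyright(y_1,\dots,y_k),\ y_j\equiv x_j\}$. For an ultrafilter $\mathcal{U}$ on $I$, $s\equiv_{\mathcal{U}}t$ iff $\{i:\pi_i(s)=\pi_i(t)\}\in\mathcal{U}$, and the ultraproduct $\Pi_{\mathcal{U}}\mathbb{M}_i$ is the quotient of the product by $\equiv_{\mathcal{U}}$. A class is closed under ultraproducts if it contains every ultraproduct (over any index set and ultrafilter) of any family of its members. *)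

theory Defs
  imports "HOL-Library.Countable_Set" "HOL-Library.FuncSet"
begin

section \<open>Formulas and multiple-conclusion logics\<close>

type_synonym 'c signature = "nat \<Rightarrow> 'c set"

datatype ('c, 'p) fm = Var 'p | Con 'c "('c, 'p) fm list"

inductive_set Fm :: "'c signature \<Rightarrow> 'p set \<Rightarrow> ('c, 'p) fm set"
  for Sig :: "'c signature" and P :: "'p set" where
  Var: "p \<in> P \<Longrightarrow> Var p \<in> Fm Sig P"
| Con: "c \<in> Sig (length \<phi>s) \<Longrightarrow> (\<forall>\<phi>\<in>set \<phi>s. \<phi> \<in> Fm Sig P) \<Longrightarrow> Con c \<phi>s \<in> Fm Sig P"

primrec subst :: "('p \<Rightarrow> ('c, 'p) fm) \<Rightarrow> ('c, 'p) fm \<Rightarrow> ('c, 'p) fm" where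
  "subst \<sigma> (Var p) = \<sigma> p"
| "subst \<sigma> (Con c \<phi>s) = Con c (map (subst \<sigma>) \<phi>s)"

type_synonym ('c, 'p) mc_rel = "(('c, 'p) fm set \<times> ('c, 'p) fm set) set"

definition mc_logic :: "'c signature \<Rightarrow> 'p set \<Rightarrow> ('c, 'p) mc_rel \<Rightarrow> bool" where
  "mc_logic Sig P L \<longleftrightarrow>
     L \<subseteq> Pow (Fm Sig P) \<times> Pow (Fm Sig P) \<and>
     (\<forall>\<Gamma> \<Delta>. \<Gamma> \<subseteq> Fm Sig P \<and> \<Delta> \<subseteq> Fm Sig P \<and> \<Gamma> \<inter> \<Delta> \<noteq> {} \<longrightarrow> (\<Gamma>, \<Delta>) \<in> L) \<and>
     (\<forall>\<Gamma> \<Delta> \<Gamma>' \<Delta>'. \<Gamma>' \<subseteq> Fm Sig P \<and> \<Delta>' \<subseteq> Fm Sig P \<and> (\<Gamma>, \<Delta>) \<in> L \<longrightarrow>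
        (\<Gamma> \<union> \<Gamma>', \<Delta> \<union> \<Delta>') \<in> L) \<and>
     (\<forall>\<Gamma> \<Delta>. \<Gamma> \<subseteq> Fm Sig P \<and> \<Delta> \<subseteq> Fm Sig P \<and>
        (\<forall>\<Omega>. \<Omega> \<subseteq> Fm Sig P \<longrightarrow> (\<Gamma> \<union> \<Omega>, (Fm Sig P - \<Omega>) \<union> \<Delta>) \<in> L) \<longrightarrow> (\<Gamma>, \<Delta>) \<in> L) \<and>
     (\<forall>\<Gamma> \<Delta> \<sigma>. (\<Gamma>, \<Delta>) \<in> L \<and> \<sigma> \<in> P \<rightarrow> Fm Sig P \<longrightarrow> (subst \<sigma> ` \<Gamma>, subst \<sigma> ` \<Delta>) \<in> L)"

definition compact_logic :: "('c, 'p) mc_rel \<Rightarrow> bool" where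
  "compact_logic L \<longleftrightarrow>
     (\<forall>\<Gamma> \<Delta>. (\<Gamma>, \<Delta>) \<in> L \<longrightarrow>
        (\<exists>\<Gamma>\<^sub>0 \<Delta>\<^sub>0. finite \<Gamma>\<^sub>0 \<and> finite \<Delta>\<^sub>0 \<and> \<Gamma>\<^sub>0 \<subseteq> \<Gamma> \<and> \<Delta>\<^sub>0 \<subseteq> \<Delta> \<and> (\<Gamma>\<^sub>0, \<Delta>\<^sub>0) \<in> L))"

section \<open>Nmatrices\<close>

text \<open>The value of \<^emph>\<open>interp\<close> is meaningful only on lists of elements of the carrier whose
  length is an arity of the connective.\<close>

record ('c, 'a) nmatrix =
  carrier :: "'a set"
  interp :: "'c \<Rightarrow> 'a list \<Rightarrow> 'a set"
  desig :: "'a set"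

definition nmatrix :: "'c signature \<Rightarrow> ('c, 'a) nmatrix \<Rightarrow> bool" where
  "nmatrix Sig M \<longleftrightarrow>
     desig M \<subseteq> carrier M \<and>
     (\<forall>k. \<forall>c\<in>Sig k. \<forall>xs. length xs = k \<and> set xs \<subseteq> carrier M \<longrightarrow>
        interp M c xs \<subseteq> carrier M \<and> interp M c xs \<noteq> {})"

definition valuation ::
  "'c signature \<Rightarrow> 'p set \<Rightarrow> ('c, 'a) nmatrix \<Rightarrow> (('c, 'p) fm \<Rightarrow> 'a) \<Rightarrow> bool" where
  "valuation Sig P M v \<longleftrightarrow>
     v \<in> Fm Sig P \<rightarrow> carrier M \<and>
     (\<forall>c \<phi>s. Con c \<phi>s \<in> Fm Sig P \<longrightarrow> v (Con c \<phi>s) \<in> interp M c (map v \<phi>s))"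

definition nm_consequence :: "'c signature \<Rightarrow> 'p set \<Rightarrow> ('c, 'a) nmatrix \<Rightarrow> ('c, 'p) mc_rel" where
  "nm_consequence Sig P M =
     {(\<Gamma>, \<Delta>). \<Gamma> \<subseteq> Fm Sig P \<and> \<Delta> \<subseteq> Fm Sig P \<and>
        (\<forall>v. valuation Sig P M v \<and> v ` \<Gamma> \<subseteq> desig M \<longrightarrow> v ` \<Delta> \<inter> desig M \<noteq> {})}"

definition Nmatr :: "'c signature \<Rightarrow> 'p set \<Rightarrow> ('c, 'p) mc_rel \<Rightarrow> ('c, 'a) nmatrix set" where
  "Nmatr Sig P L = {M. nmatrix Sig M \<and> L \<subseteq> nm_consequence Sig P M}"

section \<open>Ultraproducts\<close>

definition nm_product :: "'i set \<Rightarrow> ('i \<Rightarrow> ('c, 'a) nmatrix) \<Rightarrow> ('c, 'i \<Rightarrow> 'a) nmatrix" where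
  "nm_product I M =
     \<lparr>carrier = (\<Pi>\<^sub>E i\<in>I. carrier (M i)),
      interp = (\<lambda>c ss. \<Pi>\<^sub>E i\<in>I. interp (M i) c (map (\<lambda>s. s i) ss)),
      desig = (\<Pi>\<^sub>E i\<in>I. desig (M i))\<rparr>"

definition nm_quotient :: "('c, 'a) nmatrix \<Rightarrow> ('a \<times> 'a) set \<Rightarrow> ('c, 'a set) nmatrix" where
  "nm_quotient M r =
     \<lparr>carrier = carrier M // r,
      interp = (\<lambda>c Xs. {r `` {y} |y. \<exists>ys. list_all2 (\<in>) ys Xs \<and> y \<in> interp M c ys}),
      desig = {r `` {x} |x. x \<in> desig M}\<rparr>"

definition ultrafilter_on :: "'i set \<Rightarrow> 'i set set \<Rightarrow> bool" where
  "ultrafilter_on I U \<longleftrightarrow>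
     U \<subseteq> Pow I \<and> I \<in> U \<and> {} \<notin> U \<and>
     (\<forall>X Y. X \<in> U \<and> Y \<in> U \<longrightarrow> X \<inter> Y \<in> U) \<and>
     (\<forall>X Y. X \<in> U \<and> X \<subseteq> Y \<and> Y \<subseteq> I \<longrightarrow> Y \<in> U) \<and>
     (\<forall>X. X \<subseteq> I \<longrightarrow> X \<in> U \<or> I - X \<in> U)"

definition ultra_rel :: "'i set \<Rightarrow> 'i set set \<Rightarrow> ('i \<Rightarrow> 'a) set \<Rightarrow> (('i \<Rightarrow> 'a) \<times> ('i \<Rightarrow> 'a)) set" where
  "ultra_rel I U A = {(s, t). s \<in> A \<and> t \<in> A \<and> {i \<in> I. s i = t i} \<in> U}"

definition ultraproduct ::
  "'i set \<Rightarrow> 'i set set \<Rightarrow> ('i \<Rightarrow> ('c, 'a) nmatrix) \<Rightarrow> ('c, ('i \<Rightarrow> 'a) set) nmatrix" where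
  "ultraproduct I U M =
     nm_quotient (nm_product I M) (ultra_rel I U (carrier (nm_product I M)))"

text \<open>The carrier type of an ultraproduct differs from that of its factors, so a class of
  Nmatrices enters as two type instances: \<^emph>\<open>K\<close> holds its members with carriers in \<^typ>\<open>'a\<close>,
  \<^emph>\<open>K'\<close> those with carriers in \<^typ>\<open>('i \<Rightarrow> 'a) set\<close>.
  Carriers and index sets are arbitrary subsets of the types, which therefore act as size bounds;
  since there are only countably many formulas, any infinite types are large enough for
  closure to imply compactness.\<close>

definition closed_under_ultraproducts ::
  "('c, 'a) nmatrix set \<Rightarrow> ('c, ('i \<Rightarrow> 'a) set) nmatrix set \<Rightarrow> bool" where
  "closed_under_ultraproducts K K' \<longleftrightarrow>
     (\<forall>(I :: 'i set) U M. ultrafilter_on I U \<and> (\<forall>i\<in>I. M i \<in> K) \<longrightarrow> ultraproduct I U M \<in> K')"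

end

theory Submission
  imports Defs
begin

text \<open>A valuation of an ultraproduct is, formula by formula, the class of a family of valuations of
  the factors: choose representatives \<open>s\<close> of the values and repair them recursively, replacing
  \<open>s (c(\<phi>\<^sub>1,\<dots>,\<phi>\<^sub>k)) i\<close> by an admissible value wherever it is not one; by induction on formulas the
  repair changes nothing on a set of the ultrafilter. Hence a counterexample in the ultraproduct
  to a finite sequent is a counterexample in some factor, and compactness gives closure.

  Conversely, suppose that \<open>\<Gamma> \<tturnstile> \<Delta>\<close> holds but none of its finite parts does. By (C), the \<open>n\<close>-th
  finite part is separated by some \<open>\<Omega>\<^sub>n\<close> such that \<open>\<Omega>\<^sub>n\<close> does not entail its complement, and by (S) the Lindenbaum
  matrix with designated set \<open>\<Omega>\<^sub>n\<close> is a model of the logic. In an ultraproduct of these matrices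
  over a free ultrafilter the diagonal valuation refutes \<open>\<Gamma> \<tturnstile> \<Delta>\<close>.

  A factor with no designated values makes the product's designated set empty whatever the
  ultrafilter is, so it needs separate treatment in both directions.\<close>

section \<open>Ultrafilters\<close>

lemma ultrafilter_on_Int: "ultrafilter_on I U \<Longrightarrow> X \<in> U \<Longrightarrow> Y \<in> U \<Longrightarrow> X \<inter> Y \<in> U"
  unfolding ultrafilter_on_def by blast

lemma ultrafilter_on_mono: "ultrafilter_on I U \<Longrightarrow> X \<in> U \<Longrightarrow> X \<subseteq> Y \<Longrightarrow> Y \<subseteq> I \<Longrightarrow> Y \<in> U"
  unfolding ultrafilter_on_def by blast

lemma ultrafilter_on_compl: "ultrafilter_on I U \<Longrightarrow> X \<subseteq> I \<Longrightarrow> X \<notin> U \<Longrightarrow> I - X \<in> U"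
  unfolding ultrafilter_on_def by blast

lemma ultrafilter_on_top: "ultrafilter_on I U \<Longrightarrow> I \<in> U"
  unfolding ultrafilter_on_def by blast

lemma ultrafilter_on_nonempty: "ultrafilter_on I U \<Longrightarrow> X \<in> U \<Longrightarrow> X \<noteq> {}"
  unfolding ultrafilter_on_def by blast

text \<open>Iterates closure under intersection. It serves both the argument positions of a
  connective and the members of a finite sequent.\<close>

lemma ultrafilter_on_finite_ball:
  assumes U: "ultrafilter_on I U" and "finite F" and "\<And>x. x \<in> F \<Longrightarrow> {i \<in> I. Q x i} \<in> U"
  shows "{i \<in> I. \<forall>x\<in>F. Q x i} \<in> U"
  using assms(2,3)
proof (induction F rule: finite_induct)
  case empty
  show ?case using ultrafilter_on_top[OF U] by simp
next
  case (insert a F)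
  have "{i \<in> I. Q a i} \<inter> {i \<in> I. \<forall>x\<in>F. Q x i} \<in> U"
    using insert by (intro ultrafilter_on_Int[OF U]) auto
  moreover have "{i \<in> I. Q a i} \<inter> {i \<in> I. \<forall>x\<in>F. Q x i} = {i \<in> I. \<forall>x\<in>insert a F. Q x i}"
    by auto
  ultimately show ?case by simp
qed

text \<open>Zorn's lemma on the family \<open>A\<close> of filters that contain all cofinite sets
  and have only infinite members; a maximal one decides every subset of \<open>I\<close>.\<close>

lemma ex_free_ultrafilter_on:
  assumes "infinite I"
  obtains U where "ultrafilter_on I U" and "\<And>X. finite X \<Longrightarrow> I - X \<in> U"
proof -
  define A where "A = {F. F \<subseteq> Pow I \<and> (\<forall>X\<in>F. infinite X) \<and> (\<forall>X\<in>F. \<forall>Y\<in>F. X \<inter> Y \<in> F) \<and>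
    (\<forall>X Y. X \<in> F \<and> X \<subseteq> Y \<and> Y \<subseteq> I \<longrightarrow> Y \<in> F) \<and> (\<forall>X. finite X \<longrightarrow> I - X \<in> F)}"
  have "{Y. Y \<subseteq> I \<and> finite (I - Y)} \<in> A"
  proof -
    have "infinite X" if "X \<subseteq> I" "finite (I - X)" for X
      using assms that by (metis finite_Diff2)
    moreover have "finite (I - Y)" if "finite (I - X)" "X \<subseteq> Y" for X Y
      using that by (meson Diff_mono finite_subset order_refl)
    moreover have "finite (I - X \<inter> Y)" if "finite (I - X)" "finite (I - Y)" for X Y
      using that by (simp add: Diff_Int)
    moreover have "finite (I - (I - X))" if "finite X" for X
      using that by (simp add: Diff_Diff_Int)
    ultimately show ?thesis
      unfolding A_def mem_Collect_eq by (intro conjI) blast+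
  qed
  then have "A \<noteq> {}" by blast
  have A_sub: "F \<subseteq> Pow I" and A_inf: "\<And>X. X \<in> F \<Longrightarrow> infinite X"
    and A_Int: "\<And>X Y. X \<in> F \<Longrightarrow> Y \<in> F \<Longrightarrow> X \<inter> Y \<in> F"
    and A_up: "\<And>X Y. X \<in> F \<Longrightarrow> X \<subseteq> Y \<Longrightarrow> Y \<subseteq> I \<Longrightarrow> Y \<in> F"
    and A_cof: "\<And>X. finite X \<Longrightarrow> I - X \<in> F"
    if "F \<in> A" for F
    using that unfolding A_def mem_Collect_eq by simp_all
  have "\<Union>C \<in> A" if "C \<noteq> {}" and "subset.chain A C" for C
  proof -
    have CA: "F \<in> A" if "F \<in> C" for F
      using that \<open>subset.chain A C\<close> by (auto simp: subset.chain_def)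
    have "X \<inter> Y \<in> \<Union>C" if XY: "X \<in> F" "F \<in> C" "Y \<in> G" "G \<in> C" for X Y F G
    proof -
      have "F \<subseteq> G \<or> G \<subseteq> F"
        using XY \<open>subset.chain A C\<close> unfolding subset.chain_def by blast
      then obtain H where "H \<in> C" "X \<in> H" "Y \<in> H" using XY by blast
      then show ?thesis using A_Int[OF CA] by blast
    qed
    moreover have "\<forall>X. finite X \<longrightarrow> I - X \<in> \<Union>C"
      using A_cof[OF CA] \<open>C \<noteq> {}\<close> by blast
    moreover have "\<Union>C \<subseteq> Pow I"
      using A_sub[OF CA] by blast
    moreover have "\<forall>X\<in>\<Union>C. infinite X"
      using A_inf[OF CA] by blast
    moreover have "\<forall>X Y. X \<in> \<Union>C \<and> X \<subseteq> Y \<and> Y \<subseteq> I \<longrightarrow> Y \<in> \<Union>C"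
      using A_up[OF CA] by (meson UnionE UnionI)
    ultimately show ?thesis
      unfolding A_def mem_Collect_eq by (intro conjI) blast+
  qed
  then obtain U where U: "U \<in> A" and max: "\<And>F. F \<in> A \<Longrightarrow> U \<subseteq> F \<Longrightarrow> F = U"
    using subset_Zorn_nonempty[OF \<open>A \<noteq> {}\<close>] by metis
  note sub = A_sub[OF U] and inf = A_inf[OF U] and Int = A_Int[OF U] and up = A_up[OF U]
    and cof = A_cof[OF U]
  have IU: "I \<in> U" using cof[of "{}"] by simp
  have "I - X \<in> U" if X: "X \<subseteq> I" "X \<notin> U" for X
  proof -
    \<comment> \<open>Otherwise the filter \<open>G\<close> generated by \<open>U\<close> and
      \<open>X\<close> would still have only infinite members, and maximality would put
      \<open>X\<close> into \<open>U\<close>.\<close>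
    have "\<exists>Z\<in>U. finite (Z \<inter> X)"
    proof (rule ccontr)
      assume *: "\<not> ?thesis"
      define G where "G = {Y. Y \<subseteq> I \<and> (\<exists>Z\<in>U. Z \<inter> X \<subseteq> Y)}"
      have UG: "U \<subseteq> G" using sub unfolding G_def by blast
      have "\<forall>Y\<in>G. infinite Y" using * finite_subset unfolding G_def by blast
      moreover have "Y \<inter> Y' \<in> G" if YY: "Y \<in> G" "Y' \<in> G" for Y Y'
      proof -
        obtain Z Z' where "Z \<in> U" "Z \<inter> X \<subseteq> Y" "Z' \<in> U" "Z' \<inter> X \<subseteq> Y'"
          using YY unfolding G_def by blast
        then have "Z \<inter> Z' \<in> U" and "Z \<inter> Z' \<inter> X \<subseteq> Y \<inter> Y'" using Int by blast+
        then show ?thesis using YY unfolding G_def by blast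
      qed
      moreover have "\<forall>Y Y'. Y \<in> G \<and> Y \<subseteq> Y' \<and> Y' \<subseteq> I \<longrightarrow> Y' \<in> G"
        unfolding G_def by blast
      moreover have "\<forall>Y. finite Y \<longrightarrow> I - Y \<in> G" using cof UG by blast
      moreover have "G \<subseteq> Pow I" unfolding G_def by blast
      ultimately have "G \<in> A" unfolding A_def mem_Collect_eq by (intro conjI) blast+
      then have "G = U" using max UG by blast
      moreover have "X \<in> G" using X IU unfolding G_def by blast
      ultimately show False using X by blast
    qed
    then obtain Z where "Z \<in> U" "finite (Z \<inter> X)" by blast
    \<comment> \<open>Removing the finite overlap from \<open>Z\<close> leaves a member of
      \<open>U\<close> that is disjoint from \<open>X\<close>.\<close>
    then have "Z \<inter> (I - (Z \<inter> X)) \<in> U" using Int cof by blast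
    then show ?thesis by (rule up) auto
  qed
  then have "ultrafilter_on I U"
    using sub inf Int up IU unfolding ultrafilter_on_def by (metis finite.emptyI)
  then show ?thesis using cof that by blast
qed

section \<open>Multiple-conclusion logics\<close>

lemma mc_logic_subset:
  "mc_logic Sig P L \<Longrightarrow> (\<Gamma>, \<Delta>) \<in> L \<Longrightarrow> \<Gamma> \<subseteq> Fm Sig P \<and> \<Delta> \<subseteq> Fm Sig P"
  unfolding mc_logic_def by (drule conjunct1) blast

lemma mc_logic_overlap:
  assumes "mc_logic Sig P L" and "\<Gamma> \<subseteq> Fm Sig P" and "\<Delta> \<subseteq> Fm Sig P" and "\<Gamma> \<inter> \<Delta> \<noteq> {}"
  shows "(\<Gamma>, \<Delta>) \<in> L"
  by (rule assms(1)[unfolded mc_logic_def, THEN conjunct2, THEN conjunct1, rule_format])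
    (intro conjI assms(2-4))

lemma mc_logic_dilution:
  assumes "mc_logic Sig P L" and "(\<Gamma>, \<Delta>) \<in> L" and "\<Gamma>' \<subseteq> Fm Sig P" and "\<Delta>' \<subseteq> Fm Sig P"
  shows "(\<Gamma> \<union> \<Gamma>', \<Delta> \<union> \<Delta>') \<in> L"
  by (rule assms(1)[unfolded mc_logic_def, THEN conjunct2, THEN conjunct2, THEN conjunct1,
        rule_format])
    (intro conjI assms(2-4))

lemma mc_logic_cut:
  assumes "mc_logic Sig P L" and "\<Gamma> \<subseteq> Fm Sig P" and "\<Delta> \<subseteq> Fm Sig P"
    and "\<And>\<Omega>. \<Omega> \<subseteq> Fm Sig P \<Longrightarrow> (\<Gamma> \<union> \<Omega>, (Fm Sig P - \<Omega>) \<union> \<Delta>) \<in> L"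
  shows "(\<Gamma>, \<Delta>) \<in> L"
  by (rule assms(1)[unfolded mc_logic_def, THEN conjunct2, THEN conjunct2, THEN conjunct2,
        THEN conjunct1, THEN spec, THEN spec, THEN mp])
    (intro conjI allI impI assms(2-4))

lemma mc_logic_subst:
  assumes "mc_logic Sig P L" and "(\<Gamma>, \<Delta>) \<in> L" and "\<sigma> \<in> P \<rightarrow> Fm Sig P"
  shows "(subst \<sigma> ` \<Gamma>, subst \<sigma> ` \<Delta>) \<in> L"
  by (rule assms(1)[unfolded mc_logic_def, THEN conjunct2, THEN conjunct2, THEN conjunct2,
        THEN conjunct2, rule_format])
    (intro conjI assms(2,3))

section \<open>Valuations\<close>

text \<open>Admissibility is tested at the repaired arguments, so a repair propagates upwards. The
  value of \<open>s\<close> is kept whenever it is admissible, which lets the result agree with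
  \<open>s\<close> on a large set of indices.\<close>

primrec repair :: "('c, 'a) nmatrix \<Rightarrow> (('c, 'p) fm \<Rightarrow> 'a) \<Rightarrow> ('c, 'p) fm \<Rightarrow> 'a" where
  "repair M s (Var p) = s (Var p)"
| "repair M s (Con c \<phi>s) =
    (if s (Con c \<phi>s) \<in> interp M c (map (repair M s) \<phi>s) then s (Con c \<phi>s)
     else SOME y. y \<in> interp M c (map (repair M s) \<phi>s))"

lemma Fm_ConD: "Con c \<phi>s \<in> Fm Sig P \<Longrightarrow> c \<in> Sig (length \<phi>s) \<and> set \<phi>s \<subseteq> Fm Sig P"
  by (erule Fm.cases) auto

lemma repair_Con_mem:
  "interp M c (map (repair M s) \<phi>s) \<noteq> {} \<Longrightarrow>
    repair M s (Con c \<phi>s) \<in> interp M c (map (repair M s) \<phi>s)"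
  by (auto intro: someI)

text \<open>Every compound formula receives an element of an interpretation at carrier elements, so
  membership in the carrier propagates from the variables upwards.\<close>

lemma valuation_repair:
  assumes M: "nmatrix Sig M" and s: "\<And>p. p \<in> P \<Longrightarrow> s (Var p) \<in> carrier M"
  shows "valuation Sig P M (repair M s)"
proof -
  have interp: "interp M c xs \<subseteq> carrier M \<and> interp M c xs \<noteq> {}"
    if "c \<in> Sig (length xs)" "set xs \<subseteq> carrier M" for c xs
    using M that unfolding nmatrix_def by blast
  have car: "repair M s \<phi> \<in> carrier M" if "\<phi> \<in> Fm Sig P" for \<phi>
    using that
  proof induction
    case (Var p)
    then show ?case using s by simp
  next
    case (Con c \<phi>s)
    then have "set (map (repair M s) \<phi>s) \<subseteq> carrier M" by auto
    then show ?case
      using interp[of c "map (repair M s) \<phi>s"] Con.hyps repair_Con_mem[of M c s \<phi>s] by auto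
  qed
  have "repair M s (Con c \<phi>s) \<in> interp M c (map (repair M s) \<phi>s)" if "Con c \<phi>s \<in> Fm Sig P" for c \<phi>s
    using Fm_ConD[OF that] car by (intro repair_Con_mem interp[THEN conjunct2]) auto
  then show ?thesis using car unfolding valuation_def by blast
qed

section \<open>Valuations of ultraproducts\<close>

lemma equiv_ultra_rel:
  assumes U: "ultrafilter_on I U"
  shows "equiv A (ultra_rel I U A)"
proof (rule equivI)
  show "refl_on A (ultra_rel I U A)" "ultra_rel I U A \<subseteq> A \<times> A"
    using ultrafilter_on_top[OF U] by (auto simp: refl_on_def ultra_rel_def)
  show "sym (ultra_rel I U A)"
    by (auto simp: sym_def ultra_rel_def eq_commute)
  show "trans (ultra_rel I U A)"
  proof (rule transI)
    fix s t u assume "(s, t) \<in> ultra_rel I U A" "(t, u) \<in> ultra_rel I U A"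
    then have "s \<in> A" "u \<in> A" "{i \<in> I. s i = t i} \<inter> {i \<in> I. t i = u i} \<in> U"
      using ultrafilter_on_Int[OF U] by (auto simp: ultra_rel_def)
    then show "(s, u) \<in> ultra_rel I U A"
      using ultrafilter_on_mono[OF U, of _ "{i \<in> I. s i = u i}"] by (force simp: ultra_rel_def)
  qed
qed

abbreviation prod_rel ::
  "'i set \<Rightarrow> 'i set set \<Rightarrow> ('i \<Rightarrow> ('c, 'a) nmatrix) \<Rightarrow> (('i \<Rightarrow> 'a) \<times> ('i \<Rightarrow> 'a)) set" where
  "prod_rel I U M \<equiv> ultra_rel I U (\<Pi>\<^sub>E i\<in>I. carrier (M i))"

lemma carrier_ultraproduct:
  "carrier (ultraproduct I U M) = (\<Pi>\<^sub>E i\<in>I. carrier (M i)) // prod_rel I U M"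
  by (simp add: ultraproduct_def nm_quotient_def nm_product_def)

lemma interp_ultraproduct:
  "interp (ultraproduct I U M) c Xs =
    {prod_rel I U M `` {y} |y. \<exists>ys. list_all2 (\<in>) ys Xs \<and>
       y \<in> (\<Pi>\<^sub>E i\<in>I. interp (M i) c (map (\<lambda>s. s i) ys))}"
  by (simp add: ultraproduct_def nm_quotient_def nm_product_def)

lemma desig_ultraproduct:
  "desig (ultraproduct I U M) = {prod_rel I U M `` {x} |x. x \<in> (\<Pi>\<^sub>E i\<in>I. desig (M i))}"
  by (simp add: ultraproduct_def nm_quotient_def nm_product_def)

text \<open>For nonemptiness, choose a representative in each argument class; the factors assign
  nonempty sets to these, and a product of nonempty sets is nonempty.\<close>

lemma nmatrix_ultraproduct:
  assumes U: "ultrafilter_on I U" and M: "\<And>i. i \<in> I \<Longrightarrow> nmatrix Sig (M i)"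
  shows "nmatrix Sig (ultraproduct I U M)"
  unfolding nmatrix_def
proof (intro conjI allI ballI impI)
  let ?A = "\<Pi>\<^sub>E i\<in>I. carrier (M i)" and ?r = "prod_rel I U M"
  have "(\<Pi>\<^sub>E i\<in>I. desig (M i)) \<subseteq> ?A"
    using M by (intro PiE_mono) (auto simp: nmatrix_def)
  then show "desig (ultraproduct I U M) \<subseteq> carrier (ultraproduct I U M)"
    unfolding desig_ultraproduct carrier_ultraproduct by (auto intro!: quotientI)
  fix k c Xs
  assume c: "c \<in> Sig k" and "length Xs = k \<and> set Xs \<subseteq> carrier (ultraproduct I U M)"
  then have len: "length Xs = k" and Xs: "\<And>X. X \<in> set Xs \<Longrightarrow> X \<in> ?A // ?r"
    by (auto simp: carrier_ultraproduct)
  have interp: "interp (M i) c (map (\<lambda>s. s i) ys) \<subseteq> carrier (M i)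
      \<and> interp (M i) c (map (\<lambda>s. s i) ys) \<noteq> {}"
    if "i \<in> I" "list_all2 (\<in>) ys Xs" for i ys
  proof -
    have "y \<in> ?A" if y: "y \<in> set ys" for y
    proof -
      obtain n where "n < length ys" "y = ys ! n" using y by (metis in_set_conv_nth)
      then have "y \<in> Xs ! n" "Xs ! n \<in> ?A // ?r"
        using \<open>list_all2 (\<in>) ys Xs\<close> Xs by (auto simp: list_all2_conv_all_nth)
      then show ?thesis using in_quotient_imp_subset[OF equiv_ultra_rel[OF U]] by blast
    qed
    then have "set (map (\<lambda>s. s i) ys) \<subseteq> carrier (M i)" using \<open>i \<in> I\<close> by auto
    moreover have "length (map (\<lambda>s. s i) ys) = k" using that len by (auto dest: list_all2_lengthD)
    ultimately show ?thesis using M[OF \<open>i \<in> I\<close>] c unfolding nmatrix_def by blast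
  qed
  show "interp (ultraproduct I U M) c Xs \<subseteq> carrier (ultraproduct I U M)"
  proof
    fix Y assume "Y \<in> interp (ultraproduct I U M) c Xs"
    then obtain y ys where "Y = ?r `` {y}" "list_all2 (\<in>) ys Xs"
      "y \<in> (\<Pi>\<^sub>E i\<in>I. interp (M i) c (map (\<lambda>s. s i) ys))"
      unfolding interp_ultraproduct by blast
    moreover from this have "y \<in> ?A" using interp by (force simp: PiE_iff)
    ultimately show "Y \<in> carrier (ultraproduct I U M)"
      by (auto simp: carrier_ultraproduct intro: quotientI)
  qed
  have ne: "X \<noteq> {}" if "X \<in> set Xs" for X
    using Xs[OF that] in_quotient_imp_non_empty[OF equiv_ultra_rel[OF U]] by blast
  then have "list_all2 (\<in>) (map (\<lambda>X. SOME x. x \<in> X) Xs) Xs"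
    by (auto simp: list_all2_conv_all_nth some_in_eq)
  moreover from this have
    "(\<Pi>\<^sub>E i\<in>I. interp (M i) c (map (\<lambda>s. s i) (map (\<lambda>X. SOME x. x \<in> X) Xs))) \<noteq> {}"
    unfolding PiE_eq_empty_iff using interp by blast
  ultimately show "interp (ultraproduct I U M) c Xs \<noteq> {}"
    unfolding interp_ultraproduct by blast
qed

text \<open>Transfers a valuation of the ultraproduct to the factors, in the manner of the theorem
  of Los. The large set on which \<open>w i\<close> agrees with the chosen representative depends on
  the formula, so in general only finitely many formulas can be controlled at once.\<close>

lemma ultraproduct_valuation_factors:
  assumes U: "ultrafilter_on I U" and M: "\<And>i. i \<in> I \<Longrightarrow> nmatrix Sig (M i)"
    and v: "valuation Sig P (ultraproduct I U M) v"
  obtains w where "\<And>i. i \<in> I \<Longrightarrow> valuation Sig P (M i) (w i)"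
    and "\<And>\<phi>. \<phi> \<in> Fm Sig P \<Longrightarrow> (\<lambda>i\<in>I. w i \<phi>) \<in> v \<phi>"
proof -
  let ?A = "\<Pi>\<^sub>E i\<in>I. carrier (M i)" and ?r = "prod_rel I U M"
  note eq = equiv_ultra_rel[OF U, of ?A]
  define s where "s \<phi> = (SOME x. x \<in> v \<phi>)" for \<phi>
  define w where "w i = repair (M i) (\<lambda>\<phi>. s \<phi> i)" for i
  have vQ: "v \<phi> \<in> ?A // ?r" if "\<phi> \<in> Fm Sig P" for \<phi>
    using v that by (auto simp: valuation_def carrier_ultraproduct)
  have sv: "s \<phi> \<in> v \<phi>" if "\<phi> \<in> Fm Sig P" for \<phi>
    unfolding s_def using in_quotient_imp_non_empty[OF eq vQ[OF that]] by (simp add: some_in_eq)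
  have sA: "s \<phi> \<in> ?A" if "\<phi> \<in> Fm Sig P" for \<phi>
    using sv[OF that] in_quotient_imp_subset[OF eq vQ[OF that]] by blast
  have agree: "{i \<in> I. x i = y i} \<in> U" if "\<phi> \<in> Fm Sig P" "x \<in> v \<phi>" "y \<in> v \<phi>" for \<phi> x y
    using quotient_eq_iff[OF eq vQ[OF that(1)] vQ[OF that(1)] that(2,3)] by (simp add: ultra_rel_def)
  have val: "valuation Sig P (M i) (w i)" if "i \<in> I" for i
    unfolding w_def using sA that by (intro valuation_repair M) (auto simp: PiE_iff intro: Fm.Var)
  have ws: "{i \<in> I. w i \<phi> = s \<phi> i} \<in> U" if "\<phi> \<in> Fm Sig P" for \<phi>
    using that
  proof induction
    case (Var p)
    then show ?case using ultrafilter_on_top[OF U] by (simp add: w_def)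
  next
    case (Con c \<phi>s)
    let ?\<phi> = "Con c \<phi>s"
    have Fm: "?\<phi> \<in> Fm Sig P" using Con by (auto intro: Fm.Con)
    then have "v ?\<phi> \<in> interp (ultraproduct I U M) c (map v \<phi>s)"
      using v by (auto simp: valuation_def)
    \<comment> \<open>The witnesses \<open>y\<close> and \<open>ys\<close> supplied by the quotient
      need not be the representatives chosen by \<open>s\<close>; they agree with them only on large
      sets, by \<open>agree\<close>.\<close>
    then obtain y ys where y: "v ?\<phi> = ?r `` {y}" and ys: "list_all2 (\<in>) ys (map v \<phi>s)"
      and yI: "y \<in> (\<Pi>\<^sub>E i\<in>I. interp (M i) c (map (\<lambda>s. s i) ys))"
      unfolding interp_ultraproduct by blast
    \<comment> \<open>The class of \<open>y\<close> contains \<open>s ?\<phi>\<close>, which forces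
      \<open>y\<close> into the carrier of the product and hence into its own class.\<close>
    have "y \<in> v ?\<phi>"
      using sv[OF Fm] unfolding y by (auto simp: ultra_rel_def ultrafilter_on_top[OF U])
    then have 1: "{i \<in> I. y i = s ?\<phi> i} \<in> U" using agree Fm sv by blast
    have lys: "length ys = length \<phi>s" using ys by (auto dest: list_all2_lengthD)
    have "{i \<in> I. (ys ! n) i = w i (\<phi>s ! n)} \<in> U" if "n < length \<phi>s" for n
    proof -
      have "\<phi>s ! n \<in> Fm Sig P" "ys ! n \<in> v (\<phi>s ! n)" "{i \<in> I. w i (\<phi>s ! n) = s (\<phi>s ! n) i} \<in> U"
        using that Con.IH ys by (auto simp: list_all2_conv_all_nth)
      then have "{i \<in> I. w i (\<phi>s ! n) = s (\<phi>s ! n) i} \<inter> {i \<in> I. (ys ! n) i = s (\<phi>s ! n) i} \<in> U"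
        using agree sv ultrafilter_on_Int[OF U] by blast
      then show ?thesis by (rule ultrafilter_on_mono[OF U]) auto
    qed
    then have "{i \<in> I. \<forall>n\<in>{..<length \<phi>s}. (ys ! n) i = w i (\<phi>s ! n)} \<in> U"
      by (intro ultrafilter_on_finite_ball[OF U]) auto
    then have "{i \<in> I. y i = s ?\<phi> i} \<inter> {i \<in> I. \<forall>n\<in>{..<length \<phi>s}. (ys ! n) i = w i (\<phi>s ! n)} \<in> U"
      using 1 ultrafilter_on_Int[OF U] by blast
    \<comment> \<open>At such an index the value of \<open>s\<close> is already admissible at the
      repaired arguments, so \<open>repair\<close> leaves it alone.\<close>
    moreover have "w i ?\<phi> = s ?\<phi> i"
      if "i \<in> I" "y i = s ?\<phi> i" "\<forall>n\<in>{..<length \<phi>s}. (ys ! n) i = w i (\<phi>s ! n)" for i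
    proof -
      have "map (\<lambda>s. s i) ys = map (w i) \<phi>s"
        using that(3) lys by (auto simp: list_eq_iff_nth_eq)
      then have "s ?\<phi> i \<in> interp (M i) c (map (w i) \<phi>s)"
        using PiE_mem[OF yI that(1)] that(2) by simp
      then show ?thesis by (simp add: w_def)
    qed
    ultimately show ?case by (elim ultrafilter_on_mono[OF U]) auto
  qed
  have "(\<lambda>i\<in>I. w i \<phi>) \<in> v \<phi>" if "\<phi> \<in> Fm Sig P" for \<phi>
  proof -
    have "{i \<in> I. s \<phi> i = (\<lambda>i\<in>I. w i \<phi>) i} = {i \<in> I. w i \<phi> = s \<phi> i}" by auto
    moreover have "(\<lambda>i\<in>I. w i \<phi>) \<in> ?A" using val that by (auto simp: valuation_def)
    ultimately have "(s \<phi>, \<lambda>i\<in>I. w i \<phi>) \<in> ?r"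
      using ws[OF that] sA[OF that] by (simp add: ultra_rel_def)
    then show ?thesis using in_quotient_imp_closed[OF eq vQ[OF that] sv[OF that]] by blast
  qed
  then show ?thesis using that val by blast
qed

text \<open>A designated class contains some \<open>y\<close> designated at every index, and
  \<open>x\<close> agrees with \<open>y\<close> on a large set.\<close>

lemma class_in_desig_ultraproductD:
  assumes U: "ultrafilter_on I U" and x: "x \<in> (\<Pi>\<^sub>E i\<in>I. carrier (M i))"
    and "prod_rel I U M `` {x} \<in> desig (ultraproduct I U M)"
  shows "{i \<in> I. x i \<in> desig (M i)} \<in> U"
proof -
  obtain y where y: "prod_rel I U M `` {x} = prod_rel I U M `` {y}" "y \<in> (\<Pi>\<^sub>E i\<in>I. desig (M i))"
    using assms(3) unfolding desig_ultraproduct by blast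
  have "x \<in> prod_rel I U M `` {y}"
    using equiv_class_self[OF equiv_ultra_rel[OF U] x] y by simp
  then have "{i \<in> I. y i = x i} \<in> U" by (simp add: ultra_rel_def)
  then show ?thesis by (rule ultrafilter_on_mono[OF U]) (use y in \<open>auto simp: PiE_iff\<close>)
qed

text \<open>Off the large set, \<open>x\<close> is redirected to arbitrary designated values without
  leaving its class. This is where every factor has to possess a designated value.\<close>

lemma class_in_desig_ultraproductI:
  assumes U: "ultrafilter_on I U" and x: "x \<in> (\<Pi>\<^sub>E i\<in>I. carrier (M i))"
    and D: "\<And>i. i \<in> I \<Longrightarrow> desig (M i) \<noteq> {} \<and> desig (M i) \<subseteq> carrier (M i)"
    and xU: "{i \<in> I. x i \<in> desig (M i)} \<in> U"
  shows "prod_rel I U M `` {x} \<in> desig (ultraproduct I U M)"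
proof -
  define y where "y = (\<lambda>i\<in>I. if x i \<in> desig (M i) then x i else SOME d. d \<in> desig (M i))"
  have yD: "y \<in> (\<Pi>\<^sub>E i\<in>I. desig (M i))" using D by (auto simp: y_def some_in_eq)
  then have "y \<in> (\<Pi>\<^sub>E i\<in>I. carrier (M i))" using D by (force simp: PiE_iff)
  moreover have "{i \<in> I. x i = y i} \<in> U"
    by (rule ultrafilter_on_mono[OF U xU]) (auto simp: y_def)
  ultimately have "(x, y) \<in> prod_rel I U M" using x by (simp add: ultra_rel_def)
  then have "prod_rel I U M `` {x} = prod_rel I U M `` {y}"
    by (rule equiv_class_eq[OF equiv_ultra_rel[OF U]])
  then show ?thesis using yD unfolding desig_ultraproduct by blast
qed

section \<open>Compactness implies closure\<close>

lemma NmatrI: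
  assumes "mc_logic Sig P L" and "nmatrix Sig M"
    and "\<And>\<Gamma> \<Delta> v. (\<Gamma>, \<Delta>) \<in> L \<Longrightarrow> valuation Sig P M v \<Longrightarrow> v ` \<Gamma> \<subseteq> desig M \<Longrightarrow>
      v ` \<Delta> \<inter> desig M \<noteq> {}"
  shows "M \<in> Nmatr Sig P L"
proof -
  have "L \<subseteq> nm_consequence Sig P M"
  proof (rule subrelI)
    fix \<Gamma> \<Delta> assume "(\<Gamma>, \<Delta>) \<in> L"
    then show "(\<Gamma>, \<Delta>) \<in> nm_consequence Sig P M"
      using mc_logic_subset[OF assms(1)] assms(3) by (simp add: nm_consequence_def)
  qed
  then show ?thesis using assms(2) by (simp add: Nmatr_def)
qed

lemma NmatrD:
  assumes "M \<in> Nmatr Sig P L" and "(\<Gamma>, \<Delta>) \<in> L" and "valuation Sig P M v" and "v ` \<Gamma> \<subseteq> desig M"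
  shows "v ` \<Delta> \<inter> desig M \<noteq> {}"
proof -
  have "(\<Gamma>, \<Delta>) \<in> nm_consequence Sig P M" using assms(1,2) by (auto simp: Nmatr_def)
  then show ?thesis using assms(3,4) by (simp add: nm_consequence_def)
qed

lemma ultraproduct_in_Nmatr:
  assumes L: "mc_logic Sig P L" and cpt: "compact_logic L"
    and U: "ultrafilter_on I U" and M: "\<And>i. i \<in> I \<Longrightarrow> M i \<in> Nmatr Sig P L"
  shows "ultraproduct I U M \<in> Nmatr Sig P L"
proof -
  let ?A = "\<Pi>\<^sub>E i\<in>I. carrier (M i)" and ?r = "prod_rel I U M"
  have nm: "nmatrix Sig (M i)" if "i \<in> I" for i using M[OF that] by (simp add: Nmatr_def)
  have sound: "w ` \<Delta> \<inter> desig (M i) \<noteq> {}"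
    if "i \<in> I" "(\<Gamma>, \<Delta>) \<in> L" "valuation Sig P (M i) w" "w ` \<Gamma> \<subseteq> desig (M i)" for i \<Gamma> \<Delta> w
    using NmatrD[OF M] that by blast
  have "v ` \<Delta> \<inter> desig (ultraproduct I U M) \<noteq> {}"
    if GD: "(\<Gamma>, \<Delta>) \<in> L" and v: "valuation Sig P (ultraproduct I U M) v"
      and vG: "v ` \<Gamma> \<subseteq> desig (ultraproduct I U M)" for \<Gamma> \<Delta> v
  proof
    assume vD: "v ` \<Delta> \<inter> desig (ultraproduct I U M) = {}"
    obtain \<Gamma>0 \<Delta>0 where fin: "finite \<Gamma>0" "finite \<Delta>0" and sub: "\<Gamma>0 \<subseteq> \<Gamma>" "\<Delta>0 \<subseteq> \<Delta>"
      and L0: "(\<Gamma>0, \<Delta>0) \<in> L"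
      using cpt[unfolded compact_logic_def, rule_format, OF GD] by auto
    have Fm: "\<Gamma> \<subseteq> Fm Sig P" "\<Delta> \<subseteq> Fm Sig P" using mc_logic_subset[OF L GD] by auto
    obtain w where w: "\<And>i. i \<in> I \<Longrightarrow> valuation Sig P (M i) (w i)"
      and wv: "\<And>\<phi>. \<phi> \<in> Fm Sig P \<Longrightarrow> (\<lambda>i\<in>I. w i \<phi>) \<in> v \<phi>"
      using ultraproduct_valuation_factors[OF U nm v] by blast
    have wA: "(\<lambda>i\<in>I. w i \<phi>) \<in> ?A" if "\<phi> \<in> Fm Sig P" for \<phi>
      using w that by (auto simp: valuation_def)
    \<comment> \<open>A value of \<open>v\<close> is a single class, so it is the class of any of
      its members.\<close>
    have v_eq: "v \<phi> = ?r `` {\<lambda>i\<in>I. w i \<phi>}" if "\<phi> \<in> Fm Sig P" for \<phi>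
    proof -
      have "v \<phi> \<in> ?A // ?r" using v that by (auto simp: valuation_def carrier_ultraproduct)
      then obtain x where "v \<phi> = ?r `` {x}" by (auto elim: quotientE)
      then show ?thesis
        using wv[OF that] equiv_class_eq[OF equiv_ultra_rel[OF U]] by blast
    qed
    have pos: "{i \<in> I. w i \<gamma> \<in> desig (M i)} \<in> U" if "\<gamma> \<in> \<Gamma>" for \<gamma>
    proof -
      have "\<gamma> \<in> Fm Sig P" "v \<gamma> \<in> desig (ultraproduct I U M)" using that Fm vG by auto
      then have "{i \<in> I. (\<lambda>i\<in>I. w i \<gamma>) i \<in> desig (M i)} \<in> U"
        by (intro class_in_desig_ultraproductD[OF U wA]) (simp_all add: v_eq)
      then show ?thesis by (rule ultrafilter_on_mono[OF U]) auto
    qed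
    show False
    proof (cases "\<exists>i\<in>I. desig (M i) = {}")
      case True
      then obtain i where i: "i \<in> I" "desig (M i) = {}" by blast
      then have "desig (ultraproduct I U M) = {}"
        unfolding desig_ultraproduct by (auto simp: PiE_iff)
      \<comment> \<open>With no designated values in factor \<open>i\<close> and no premises, the
        valuation \<open>w i\<close> refutes the full sequent in that factor, so compactness does
        not enter this case.\<close>
      then have "\<Gamma> = {}" using vG by blast
      then show False using sound[OF i(1) GD w[OF i(1)]] i by blast
    next
      case False
      \<comment> \<open>If \<delta> were designated on a large set,
        \<open>class_in_desig_ultraproductI\<close> would make \<open>v \<delta>\<close> designated;
        the case assumption supplies its nonemptiness condition.\<close>
      have neg: "{i \<in> I. w i \<delta> \<notin> desig (M i)} \<in> U" if "\<delta> \<in> \<Delta>" for \<delta>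
      proof -
        have \<delta>: "\<delta> \<in> Fm Sig P" "v \<delta> \<notin> desig (ultraproduct I U M)" using that Fm vD by auto
        have "{i \<in> I. (\<lambda>i\<in>I. w i \<delta>) i \<in> desig (M i)} \<notin> U"
        proof
          assume *: "{i \<in> I. (\<lambda>i\<in>I. w i \<delta>) i \<in> desig (M i)} \<in> U"
          have "\<And>i. i \<in> I \<Longrightarrow> desig (M i) \<noteq> {} \<and> desig (M i) \<subseteq> carrier (M i)"
            using False nm by (auto simp: nmatrix_def)
          from class_in_desig_ultraproductI[OF U wA[OF \<delta>(1)] this *] show False
            using \<delta>(2) unfolding v_eq[OF \<delta>(1)] by contradiction
        qed
        from ultrafilter_on_compl[OF U _ this] show ?thesis
          by (rule ultrafilter_on_mono[OF U]) auto
      qed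
      have "{i \<in> I. \<forall>\<gamma>\<in>\<Gamma>0. w i \<gamma> \<in> desig (M i)} \<in> U"
        using sub pos by (intro ultrafilter_on_finite_ball[OF U] fin) auto
      moreover have "{i \<in> I. \<forall>\<delta>\<in>\<Delta>0. w i \<delta> \<notin> desig (M i)} \<in> U"
        using sub neg by (intro ultrafilter_on_finite_ball[OF U] fin) auto
      ultimately have "{i \<in> I. \<forall>\<gamma>\<in>\<Gamma>0. w i \<gamma> \<in> desig (M i)} \<inter>
          {i \<in> I. \<forall>\<delta>\<in>\<Delta>0. w i \<delta> \<notin> desig (M i)} \<noteq> {}"
        using ultrafilter_on_Int[OF U] ultrafilter_on_nonempty[OF U] by blast
      then obtain i where "i \<in> I" "\<forall>\<gamma>\<in>\<Gamma>0. w i \<gamma> \<in> desig (M i)" "\<forall>\<delta>\<in>\<Delta>0. w i \<delta> \<notin> desig (M i)"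
        by blast
      then show False using sound[OF _ L0 w] by blast
    qed
  qed
  then show ?thesis by (intro NmatrI[OF L] nmatrix_ultraproduct[OF U nm])
qed

section \<open>Lindenbaum matrices\<close>

text \<open>The formulas are copied along an injection \<open>e\<close>, since the factors of an ultraproduct must have
  their carriers in the type \<^typ>\<open>'a\<close>.\<close>

definition lindenbaum ::
  "'c signature \<Rightarrow> 'p set \<Rightarrow> (('c, 'p) fm \<Rightarrow> 'a) \<Rightarrow> ('c, 'p) fm set \<Rightarrow> ('c, 'a) nmatrix" where
  "lindenbaum Sig P e \<Omega> =
    \<lparr>carrier = e ` Fm Sig P,
     interp = (\<lambda>c xs. {e (Con c (map (inv_into (Fm Sig P) e) xs))}),
     desig = e ` \<Omega>\<rparr>"

text \<open>Formulas are freely generated by the variables. This turns valuations of a Lindenbaum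
  matrix into substitutions, to which (S) applies.\<close>

lemma homomorphism_eq_subst:
  assumes "\<And>c \<phi>s. Con c \<phi>s \<in> Fm Sig P \<Longrightarrow> w (Con c \<phi>s) = Con c (map w \<phi>s)"
    and "\<phi> \<in> Fm Sig P"
  shows "w \<phi> = subst (\<lambda>p. w (Var p)) \<phi>"
  using assms(2)
proof induction
  case (Con c \<phi>s)
  then have "Con c \<phi>s \<in> Fm Sig P" by (auto intro: Fm.Con)
  then show ?case using assms(1)[of c \<phi>s] Con.IH by simp
qed simp

text \<open>Interpretations are singletons, so decoding a valuation gives a substitution \<sigma>.
  If it refuted a sequent of \<open>L\<close>, then \<sigma> would map the premises into \<Omega>
  and the conclusions into its complement, and (S) followed by (D) would contradict the choice of
  \<Omega>.\<close>

lemma lindenbaum_in_Nmatr: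
  assumes L: "mc_logic Sig P L" and e: "inj_on e (Fm Sig P)"
    and \<Omega>: "\<Omega> \<subseteq> Fm Sig P" "(\<Omega>, Fm Sig P - \<Omega>) \<notin> L"
  shows "lindenbaum Sig P e \<Omega> \<in> Nmatr Sig P L"
proof -
  let ?F = "Fm Sig P" and ?d = "inv_into (Fm Sig P) e"
  have d: "?d x \<in> ?F" "e (?d x) = x" if "x \<in> e ` ?F" for x
    using that by (auto intro: inv_into_into f_inv_into_f)
  have "nmatrix Sig (lindenbaum Sig P e \<Omega>)"
    using \<Omega>(1) by (auto simp: nmatrix_def lindenbaum_def intro!: imageI Fm.Con d(1))
  moreover have "v ` \<Delta> \<inter> e ` \<Omega> \<noteq> {}"
    if GD: "(\<Gamma>, \<Delta>) \<in> L" and v: "valuation Sig P (lindenbaum Sig P e \<Omega>) v"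
      and vG: "v ` \<Gamma> \<subseteq> e ` \<Omega>" for \<Gamma> \<Delta> v
  proof
    assume vD: "v ` \<Delta> \<inter> e ` \<Omega> = {}"
    have Fm: "\<Gamma> \<subseteq> ?F" "\<Delta> \<subseteq> ?F" using mc_logic_subset[OF L GD] by auto
    have vF: "v \<phi> \<in> e ` ?F" if "\<phi> \<in> ?F" for \<phi>
      using v that by (auto simp: valuation_def lindenbaum_def)
    define \<sigma> where "\<sigma> p = ?d (v (Var p))" for p
    have "?d (v (Con c \<phi>s)) = Con c (map (\<lambda>\<phi>. ?d (v \<phi>)) \<phi>s)" if F: "Con c \<phi>s \<in> ?F" for c \<phi>s
    proof -
      have "v (Con c \<phi>s) = e (Con c (map ?d (map v \<phi>s)))"
        using v F by (auto simp: valuation_def lindenbaum_def)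
      moreover have "Con c (map ?d (map v \<phi>s)) \<in> ?F"
        using Fm_ConD[OF F] by (auto intro!: Fm.Con d(1)[OF vF])
      ultimately show ?thesis using e by (simp add: comp_def)
    qed
    from homomorphism_eq_subst[of Sig P "\<lambda>\<phi>. ?d (v \<phi>)", OF this]
    have ds: "?d (v \<phi>) = subst \<sigma> \<phi>" if "\<phi> \<in> ?F" for \<phi> using that by (simp add: \<sigma>_def[abs_def])
    have es: "v \<phi> = e (subst \<sigma> \<phi>)" "subst \<sigma> \<phi> \<in> ?F" if "\<phi> \<in> ?F" for \<phi>
      using d[OF vF[OF that]] ds[OF that] by auto
    have "\<sigma> \<in> P \<rightarrow> ?F" by (auto simp: \<sigma>_def intro!: d(1)[OF vF] Fm.Var)
    then have "(subst \<sigma> ` \<Gamma>, subst \<sigma> ` \<Delta>) \<in> L" by (rule mc_logic_subst[OF L GD])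
    then have "(subst \<sigma> ` \<Gamma> \<union> \<Omega>, subst \<sigma> ` \<Delta> \<union> (?F - \<Omega>)) \<in> L"
      using \<Omega>(1) by (intro mc_logic_dilution[OF L]) auto
    moreover have "subst \<sigma> \<gamma> \<in> \<Omega>" if "\<gamma> \<in> \<Gamma>" for \<gamma>
    proof -
      have "\<gamma> \<in> ?F" "v \<gamma> \<in> e ` \<Omega>" using that Fm vG by auto
      then show ?thesis using es[of \<gamma>] inj_on_image_mem_iff[OF e _ \<Omega>(1)] by simp
    qed
    then have "subst \<sigma> ` \<Gamma> \<union> \<Omega> = \<Omega>" by blast
    moreover have "subst \<sigma> \<delta> \<in> ?F - \<Omega>" if "\<delta> \<in> \<Delta>" for \<delta>
      using vD that es[of \<delta>] Fm by blast
    then have "subst \<sigma> ` \<Delta> \<union> (?F - \<Omega>) = ?F - \<Omega>" by blast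
    ultimately show False using \<Omega>(2) by simp
  qed
  moreover have "desig (lindenbaum Sig P e \<Omega>) = e ` \<Omega>" by (simp add: lindenbaum_def)
  ultimately show ?thesis by (metis NmatrI[OF L])
qed

text \<open>The factors differ only in their designated sets and interpret connectives alike, so
  constant families are combined into constant families.\<close>

lemma valuation_diagonal:
  assumes U: "ultrafilter_on I U" and e: "inj_on e (Fm Sig P)"
  shows "valuation Sig P (ultraproduct I U (\<lambda>i. lindenbaum Sig P e (\<Omega> i)))
    (\<lambda>\<phi>. prod_rel I U (\<lambda>i. lindenbaum Sig P e (\<Omega> i)) `` {\<lambda>i\<in>I. e \<phi>})"
proof -
  let ?M = "\<lambda>i. lindenbaum Sig P e (\<Omega> i)"
  let ?A = "\<Pi>\<^sub>E i\<in>I. carrier (?M i)" and ?r = "prod_rel I U ?M"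
  have A: "(\<lambda>i\<in>I. e \<phi>) \<in> ?A" if "\<phi> \<in> Fm Sig P" for \<phi>
    using that by (auto simp: lindenbaum_def)
  have "?r `` {\<lambda>i\<in>I. e (Con c \<phi>s)} \<in>
      interp (ultraproduct I U ?M) c (map (\<lambda>\<phi>. ?r `` {\<lambda>i\<in>I. e \<phi>}) \<phi>s)"
    if F: "Con c \<phi>s \<in> Fm Sig P" for c \<phi>s
  proof -
    have sub: "\<And>\<phi>. \<phi> \<in> set \<phi>s \<Longrightarrow> \<phi> \<in> Fm Sig P" using Fm_ConD[OF F] by blast
    let ?ys = "map (\<lambda>\<phi>. \<lambda>i\<in>I. e \<phi>) \<phi>s"
    have "list_all2 (\<in>) ?ys (map (\<lambda>\<phi>. ?r `` {\<lambda>i\<in>I. e \<phi>}) \<phi>s)"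
      using equiv_class_self[OF equiv_ultra_rel[OF U] A[OF sub]]
      by (simp add: list_all2_conv_all_nth)
    moreover have "map (inv_into (Fm Sig P) e) (map (\<lambda>s. s i) ?ys) = \<phi>s" if "i \<in> I" for i
      using sub that e by (auto simp: map_idI)
    then have "(\<lambda>i\<in>I. e (Con c \<phi>s)) \<in> (\<Pi>\<^sub>E i\<in>I. interp (?M i) c (map (\<lambda>s. s i) ?ys))"
      by (auto simp: lindenbaum_def simp del: map_map)
    ultimately show ?thesis unfolding interp_ultraproduct by blast
  qed
  then show ?thesis
    using quotientI[OF A] unfolding valuation_def carrier_ultraproduct by blast
qed

text \<open>The types of connectives and variables may be uncountable, so a numbering by recursion
  on formulas is shown to be injective on \<open>Fm Sig P\<close> only.\<close>

lemma countable_Fm: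
  assumes "countable (\<Union>k. Sig k)" and "countable P"
  shows "countable (Fm Sig P)"
proof -
  define f where "f = to_nat_on P"
  define g where "g = to_nat_on (\<Union>k. Sig k)"
  have f: "inj_on f P" and g: "inj_on g (\<Union>k. Sig k)"
    using assms by (auto simp: f_def g_def)
  \<comment> \<open>The recursor passes each immediate subformula paired with its code, hence
    \<open>map snd\<close>; \<open>Inl\<close> and \<open>Inr\<close> keep variables and compound
    formulas apart.\<close>
  define h :: "('a, 'b) fm \<Rightarrow> nat" where
    "h = rec_fm (\<lambda>p. to_nat (Inl (f p) :: nat + nat \<times> nat list))
      (\<lambda>c ps. to_nat (Inr (g c, map snd ps) :: nat + nat \<times> nat list))"
  have h: "h (Var p) = to_nat (Inl (f p) :: nat + nat \<times> nat list)"
    "h (Con c \<phi>s) = to_nat (Inr (g c, map h \<phi>s) :: nat + nat \<times> nat list)" for p c \<phi>s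
    by (simp_all add: h_def comp_def)
  have "\<psi> \<in> Fm Sig P \<Longrightarrow> h \<phi> = h \<psi> \<Longrightarrow> \<phi> = \<psi>" if "\<phi> \<in> Fm Sig P" for \<phi> \<psi>
    using that
  proof (induction arbitrary: \<psi>)
    case (Var p)
    then show ?case using f by (cases rule: Fm.cases[OF Var.prems(1)]) (auto simp: h dest: inj_onD)
  next
    case (Con c \<phi>s)
    show ?case
    proof (cases rule: Fm.cases[OF Con.prems(1)])
      case (1 p)
      then show ?thesis using Con.prems(2) by (simp add: h)
    next
      case (2 d \<psi>s)
      have "g c = g d" and m: "map h \<phi>s = map h \<psi>s" using Con.prems(2) 2 by (auto simp: h)
      then have "c = d" using g Con.hyps 2 by (auto dest: inj_onD)
      moreover have "\<phi>s = \<psi>s"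
      proof (rule nth_equalityI)
        show len: "length \<phi>s = length \<psi>s" using map_eq_imp_length_eq[OF m] .
        fix n assume "n < length \<phi>s"
        moreover from this have "h (\<phi>s ! n) = h (\<psi>s ! n)" using m len by (metis nth_map)
        ultimately show "\<phi>s ! n = \<psi>s ! n" using Con.IH 2 len by simp
      qed
      ultimately show ?thesis using 2 by simp
    qed
  qed
  then have "inj_on h (Fm Sig P)" by (intro inj_onI)
  then show ?thesis by (rule countableI)
qed

section \<open>Closure implies compactness\<close>

text \<open>(C) provides \<Omega>. By (O) the two sides of the resulting non-consequence are
  disjoint, so \<Gamma> is absorbed by \<Omega> and \<Delta> by its complement.\<close>

lemma mc_logic_separation:
  assumes L: "mc_logic Sig P L" and Fm: "\<Gamma> \<subseteq> Fm Sig P" "\<Delta> \<subseteq> Fm Sig P" and "(\<Gamma>, \<Delta>) \<notin> L"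
  obtains \<Omega> where "\<Gamma> \<subseteq> \<Omega>" "\<Omega> \<subseteq> Fm Sig P" "\<Delta> \<inter> \<Omega> = {}" "(\<Omega>, Fm Sig P - \<Omega>) \<notin> L"
proof -
  let ?F = "Fm Sig P"
  obtain \<Omega> where \<Omega>: "\<Omega> \<subseteq> ?F" and n: "(\<Gamma> \<union> \<Omega>, (?F - \<Omega>) \<union> \<Delta>) \<notin> L"
    using mc_logic_cut[OF L Fm] \<open>(\<Gamma>, \<Delta>) \<notin> L\<close> by blast
  have "\<Gamma> \<union> \<Omega> \<subseteq> ?F" "(?F - \<Omega>) \<union> \<Delta> \<subseteq> ?F" using \<Omega> Fm by auto
  then have disj: "(\<Gamma> \<union> \<Omega>) \<inter> ((?F - \<Omega>) \<union> \<Delta>) = {}" using mc_logic_overlap[OF L] n by blast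
  then have "\<Gamma> \<union> \<Omega> = \<Omega>" "(?F - \<Omega>) \<union> \<Delta> = ?F - \<Omega>" using Fm by blast+
  then have n': "(\<Omega>, ?F - \<Omega>) \<notin> L" using n by simp
  have "\<Gamma> \<subseteq> \<Omega>" and "\<Delta> \<inter> \<Omega> = {}" using disj Fm by blast+
  then show ?thesis by (rule that[OF _ \<Omega> _ n'])
qed

lemma closed_under_ultraproducts_imp_compact:
  fixes Sig :: "'c signature" and P :: "'p set" and L :: "('c, 'p) mc_rel"
  assumes cSig: "countable (\<Union>k. Sig k)" and cP: "countable P"
    and L: "mc_logic Sig P L"
    and i: "infinite (UNIV :: 'i set)" and a: "infinite (UNIV :: 'a set)"
    and cl: "closed_under_ultraproducts
      (Nmatr Sig P L :: ('c, 'a) nmatrix set)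
      (Nmatr Sig P L :: ('c, ('i \<Rightarrow> 'a) set) nmatrix set)"
  shows "compact_logic L"
  unfolding compact_logic_def
proof (intro allI impI, rule ccontr)
  let ?F = "Fm Sig P"
  fix \<Gamma> \<Delta>
  assume GD: "(\<Gamma>, \<Delta>) \<in> L"
    and no: "\<not> (\<exists>\<Gamma>0 \<Delta>0. finite \<Gamma>0 \<and> finite \<Delta>0 \<and> \<Gamma>0 \<subseteq> \<Gamma> \<and> \<Delta>0 \<subseteq> \<Delta> \<and> (\<Gamma>0, \<Delta>0) \<in> L)"
  have fin: "(\<Gamma>0, \<Delta>0) \<notin> L" if "finite \<Gamma>0" "finite \<Delta>0" "\<Gamma>0 \<subseteq> \<Gamma>" "\<Delta>0 \<subseteq> \<Delta>" for \<Gamma>0 \<Delta>0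
    using no that by iprover
  have Fm: "\<Gamma> \<subseteq> ?F" "\<Delta> \<subseteq> ?F" using mc_logic_subset[OF L GD] by auto
  define num where "num = to_nat_on ?F"
  have num: "inj_on num ?F" unfolding num_def by (rule inj_on_to_nat_on[OF countable_Fm[OF cSig cP]])
  \<comment> \<open>The infinite types make room for a copy of the countably many formulas in
    \<open>'a\<close> and for a copy of the natural numbers, as index set, in
    \<open>'i\<close>.\<close>
  obtain a' :: "nat \<Rightarrow> 'a" where a': "inj a'" using infinite_countable_subset[OF a] by blast
  obtain g :: "nat \<Rightarrow> 'i" where g: "inj g" using infinite_countable_subset[OF i] by blast
  define e where "e = a' \<circ> num"
  have e: "inj_on e ?F" unfolding e_def using num a' by (auto intro: comp_inj_on inj_on_subset)
  have fin_num: "finite {\<phi> \<in> ?F. num \<phi> \<le> n}" for n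
    by (rule inj_on_finite[of num _ "{..n}"]) (auto intro: inj_on_subset[OF num])
  \<comment> \<open>One fixed element of \<open>\<Gamma>\<close>, if there is any, is put into every finite part, so that no \<open>\<Omega> n\<close>
    is empty unless \<open>\<Gamma>\<close> is.\<close>
  define G0 where "G0 = (if \<Gamma> = {} then {} else {SOME \<gamma>. \<gamma> \<in> \<Gamma>})"
  have G0: "G0 \<subseteq> \<Gamma>" "finite G0" "\<Gamma> \<noteq> {} \<Longrightarrow> G0 \<noteq> {}" by (auto simp: G0_def some_in_eq)
  define G where "G n = G0 \<union> {\<phi> \<in> \<Gamma>. num \<phi> \<le> n}" for n
  define D where "D n = {\<phi> \<in> \<Delta>. num \<phi> \<le> n}" for n
  have "\<exists>\<Omega>. G n \<subseteq> \<Omega> \<and> \<Omega> \<subseteq> ?F \<and> D n \<inter> \<Omega> = {} \<and> (\<Omega>, ?F - \<Omega>) \<notin> L" for n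
  proof -
    have "finite (G n)" "finite (D n)" "G n \<subseteq> \<Gamma>" "D n \<subseteq> \<Delta>"
      unfolding G_def D_def using G0 Fm by (auto intro: finite_subset[OF _ fin_num[of n]])
    then show ?thesis
      using mc_logic_separation[OF L, of "G n" "D n"] fin Fm by (metis order_trans)
  qed
  then obtain \<Omega> where \<Omega>: "\<And>n. G n \<subseteq> \<Omega> n" "\<And>n. \<Omega> n \<subseteq> ?F" "\<And>n. D n \<inter> \<Omega> n = {}"
    "\<And>n. (\<Omega> n, ?F - \<Omega> n) \<notin> L" by metis
  define I where "I = range g"
  define h where "h = inv g"
  have "infinite I" unfolding I_def using g by (simp add: finite_image_iff)
  then obtain U where U: "ultrafilter_on I U" and free: "\<And>X. finite X \<Longrightarrow> I - X \<in> U"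
    using ex_free_ultrafilter_on by blast
  \<comment> \<open>Only finitely many indices carry a number below \<open>n\<close>, and the
    ultrafilter is free. Each formula of \<Gamma> or \<Delta> enters the finite parts from its own
    number on, so a tail suffices to control it.\<close>
  have tail: "{i \<in> I. n \<le> h i} \<in> U" for n
  proof -
    have "I - g ` {..<n} \<subseteq> {i \<in> I. n \<le> h i}" using g by (auto simp: I_def h_def)
    then show ?thesis using free[of "g ` {..<n}"] by (auto intro: ultrafilter_on_mono[OF U])
  qed
  define M where "M i = lindenbaum Sig P e (\<Omega> (h i))" for i
  define v where "v \<phi> = prod_rel I U M `` {\<lambda>i\<in>I. e \<phi>}" for \<phi>
  have desM: "desig (M i) = e ` \<Omega> (h i)" for i by (simp add: M_def lindenbaum_def)
  have car: "(\<lambda>i\<in>I. e \<phi>) \<in> (\<Pi>\<^sub>E i\<in>I. carrier (M i))" if "\<phi> \<in> ?F" for \<phi>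
    using that by (auto simp: M_def lindenbaum_def)
  have "\<And>i. M i \<in> Nmatr Sig P L"
    unfolding M_def using \<Omega> by (intro lindenbaum_in_Nmatr[OF L e]) auto
  then have "ultraproduct I U M \<in> Nmatr Sig P L"
    using cl U unfolding closed_under_ultraproducts_def by blast
  moreover have "valuation Sig P (ultraproduct I U M) v"
    using valuation_diagonal[OF U e, of "\<lambda>i. \<Omega> (h i)"] by (simp add: M_def[abs_def] v_def[abs_def])
  moreover have "v \<gamma> \<in> desig (ultraproduct I U M)" if \<gamma>: "\<gamma> \<in> \<Gamma>" for \<gamma>
    unfolding v_def
  proof (rule class_in_desig_ultraproductI[OF U])
    show "(\<lambda>i\<in>I. e \<gamma>) \<in> (\<Pi>\<^sub>E i\<in>I. carrier (M i))" using car \<gamma> Fm by blast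
    fix i
    \<comment> \<open>Here the fixed element in \<open>G0\<close> matters: it gives every factor a
      designated value, even at indices whose number is below that of \<gamma>.\<close>
    have "G (h i) \<noteq> {}" using \<gamma> G0 by (auto simp: G_def)
    then show "desig (M i) \<noteq> {} \<and> desig (M i) \<subseteq> carrier (M i)"
      using \<Omega>(1,2)[of "h i"] by (auto simp: M_def lindenbaum_def)
  next
    have "\<gamma> \<in> \<Omega> (h i)" if "num \<gamma> \<le> h i" for i
      using \<Omega>(1)[of "h i"] \<gamma> that by (auto simp: G_def)
    then show "{i \<in> I. (\<lambda>i\<in>I. e \<gamma>) i \<in> desig (M i)} \<in> U"
      by (intro ultrafilter_on_mono[OF U tail[of "num \<gamma>"]]) (auto simp: desM)
  qed
  moreover have "v \<delta> \<notin> desig (ultraproduct I U M)" if \<delta>: "\<delta> \<in> \<Delta>" for \<delta>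
  proof
    assume "v \<delta> \<in> desig (ultraproduct I U M)"
    then have "{i \<in> I. (\<lambda>i\<in>I. e \<delta>) i \<in> desig (M i)} \<in> U"
      unfolding v_def using class_in_desig_ultraproductD[OF U car] \<delta> Fm(2) by blast
    \<comment> \<open>At an index in the tail of \<delta>, the formula already belongs to
      \<open>D (h i)\<close> and so lies outside \<open>\<Omega> (h i)\<close>.\<close>
    then have "{i \<in> I. (\<lambda>i\<in>I. e \<delta>) i \<in> desig (M i)} \<inter> {i \<in> I. num \<delta> \<le> h i} \<noteq> {}"
      using tail ultrafilter_on_Int[OF U] ultrafilter_on_nonempty[OF U] by blast
    then obtain i where "i \<in> I" "(\<lambda>i\<in>I. e \<delta>) i \<in> desig (M i)" and le: "num \<delta> \<le> h i" by blast
    then have "e \<delta> \<in> e ` \<Omega> (h i)" by (simp add: desM)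
    then have "\<delta> \<in> \<Omega> (h i)"
      using inj_on_image_mem_iff[OF e _ \<Omega>(2)] \<delta> Fm by blast
    then show False using \<Omega>(3)[of "h i"] \<delta> le by (auto simp: D_def)
  qed
  ultimately show False using NmatrD[of _ Sig P L \<Gamma> \<Delta> v] GD by blast
qed

theorem theorem30:
  fixes Sig :: "'c signature" and P :: "'p set" and L :: "('c, 'p) mc_rel"
  assumes "countable (\<Union>k. Sig k)"
    and "countable P" and "infinite P"
    and "mc_logic Sig P L"
    and "infinite (UNIV :: 'i set)" and "infinite (UNIV :: 'a set)"
  shows "compact_logic L \<longleftrightarrow>
    closed_under_ultraproducts
      (Nmatr Sig P L :: ('c, 'a) nmatrix set)
      (Nmatr Sig P L :: ('c, ('i \<Rightarrow> 'a) set) nmatrix set)"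
proof
  assume "compact_logic L"
  from ultraproduct_in_Nmatr[OF assms(4) this]
  show "closed_under_ultraproducts (Nmatr Sig P L :: ('c, 'a) nmatrix set)
      (Nmatr Sig P L :: ('c, ('i \<Rightarrow> 'a) set) nmatrix set)"
    unfolding closed_under_ultraproducts_def by blast
qed (rule closed_under_ultraproducts_imp_compact[OF assms(1,2,4-6)])

end
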